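(* Let $a$ be an integer and $p$ an odd prime with $p\nmid a(a^4-1)$. Let $\{u_n\}_{n\geq0}$ be the Lucas sequence defined by $u_0=0$, $u_1=1$, $u_{n+1}=2u_n-(a^2+1)u_{n-1}$ for $n\geq1$. For an integer $r$ put $K_{p,4,r}(a)=\sum_{1\le k\le p-1,\ k\equiv r\ (\mathrm{mod}\ 4)}\frac{(-a)^k}{k}$. Then, if $p\equiv1\pmod4$, $$\frac{u_{p-1}}{p}\equiv\frac{2}{a(a^2+1)}\big(aK_{p,4,0}(a)-K_{p,4,1}(a)\big)+\frac{2}{a^2+1}q_p(a)+\frac{a^2-1}{2a(a^2+1)}\big(q_p(a+1)-q_p(a-1)\big)\pmod p;$$ and if $p\equiv3\pmod4$, $$\frac{u_{p+1}}{p}\equiv-\frac{2}{a}\big(aK_{p,4,0}(a)+K_{p,4,1}(a)\big)-\frac{(a+1)^2}{2a}q_p(a+1)+\frac{(a-1)^2}{2a}q_p(a-1)\pmod p.$$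
   Context: For an odd prime $p$ and an integer $x$ with $p\nmid x$, $q_p(x)=\frac{x^{p-1}-1}{p}$ is the Fermat quotient. Congruences modulo $p$ between rational numbers with denominators prime to $p$ are understood in the ring of $p$-integral rationals. *)

theory Defs
  imports Complex_Main "HOL-Number_Theory.Number_Theory"
begin

(* quotient_of returns the fraction in lowest terms with positive denominator. *)
definition p_integral :: "nat \<Rightarrow> rat \<Rightarrow> bool" where
  "p_integral p x \<longleftrightarrow> \<not> int p dvd snd (quotient_of x)"

(* Congruence in the ring of p-integral rationals; it includes the claim that both
   sides lie in that ring. *)
definition rat_cong :: "rat \<Rightarrow> rat \<Rightarrow> nat \<Rightarrow> bool" where
  "rat_cong x y p \<longleftrightarrow>
     p_integral p x \<and> p_integral p y \<and> (\<exists>z. p_integral p z \<and> x - y = of_nat p * z)"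

definition fermat_quotient :: "nat \<Rightarrow> int \<Rightarrow> rat" where
  "fermat_quotient p x = (of_int x ^ (p - 1) - 1) / of_nat p"

fun lucas_u :: "int \<Rightarrow> int \<Rightarrow> nat \<Rightarrow> int" where
  "lucas_u A B 0 = 0"
| "lucas_u A B (Suc 0) = 1"
| "lucas_u A B (Suc (Suc n)) = A * lucas_u A B (Suc n) - B * lucas_u A B n"

definition K_sum :: "nat \<Rightarrow> nat \<Rightarrow> int \<Rightarrow> int \<Rightarrow> rat" where
  "K_sum p m r a =
     (\<Sum>k \<in> {k. 1 \<le> k \<and> k \<le> p - 1 \<and> [int k = r] (mod int m)}. (- of_int a) ^ k / of_nat k)"

end

theory Submission
  imports Defs
begin

text \<open>
  Put \<open>\<alpha> = 1 + a\<i>\<close>, so that \<open>a u\<^sub>n = Im (\<alpha>\<^sup>n)\<close>. Expanding \<open>(1 + wa)\<^sup>p\<close> binomially for the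
  fourth roots of unity \<open>w = 1, -1, \<i>\<close> and grouping the inner terms by their exponent modulo 4
  gives linear equations between four partial sums \<open>S\<^sub>0, ..., S\<^sub>3\<close>, the Fermat quotients of
  \<open>a\<close> and \<open>a \<plusminus> 1\<close>, and \<open>\<alpha>\<^sup>p\<close>. Eliminating \<open>S\<^sub>2\<close> and \<open>S\<^sub>3\<close> yields both formulas as exact
  identities, with \<open>- S\<^sub>r / p\<close> in place of \<open>K\<^sub>r\<close>. Finally \<open>S\<^sub>r / p \<equiv> - K\<^sub>r\<close> modulo \<open>p\<close>, because
  \<open>(p choose k) / p = (p - 1 choose k - 1) / k\<close> and \<open>(p - 1 choose k - 1) \<equiv> (- 1)\<^sup>k\<^sup>-\<^sup>1\<close>.
\<close>

section \<open>Rationals that are integral at a prime\<close>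

text \<open>The reduced denominator divides the denominator of every other representation, so any
  fraction with denominator prime to \<open>p\<close> serves as a witness. The closure properties
  can thus be proved without normal forms.\<close>

lemma p_integral_iff:
  "p_integral p x \<longleftrightarrow> (\<exists>m n. \<not> int p dvd n \<and> x = of_int m / of_int n)"
proof
  assume "p_integral p x"
  then show "\<exists>m n. \<not> int p dvd n \<and> x = of_int m / of_int n"
    unfolding p_integral_def
    by (metis prod.collapse quotient_of_div)
next
  assume "\<exists>m n. \<not> int p dvd n \<and> x = of_int m / of_int n"
  then obtain m n where n: "\<not> int p dvd n" and x: "x = of_int m / of_int n" by blast
  obtain m' n' where q: "quotient_of x = (m', n')" by fastforce
  have n0: "n \<noteq> 0" using n by auto
  have n'0: "n' > 0" and cop: "coprime m' n'" and x': "x = of_int m' / of_int n'"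
    using quotient_of_denom_pos[OF q] quotient_of_coprime[OF q] quotient_of_div[OF q] by auto
  have "(of_int (m * n') :: rat) = of_int (m' * n)"
    using x x' n0 n'0 by (simp add: field_simps)
  then have "m * n' = m' * n" by (simp only: of_int_eq_iff)
  then have "n' dvd m' * n" by (metis dvd_triv_right)
  then have "n' dvd n" using cop by (simp add: coprime_commute coprime_dvd_mult_right_iff)
  then show "p_integral p x"
    unfolding p_integral_def q using n by (auto intro: dvd_trans)
qed

lemma p_integral_of_int [simp]: "prime p \<Longrightarrow> p_integral p (of_int m)"
  unfolding p_integral_iff
  by (rule exI[of _ m], rule exI[of _ 1]) (use not_prime_unit in auto)

lemma p_integral_add [intro]:
  assumes "prime p" "p_integral p x" "p_integral p y"
  shows "p_integral p (x + y)"
proof -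
  obtain m n m' n' where *: "\<not> int p dvd n" "x = of_int m / of_int n"
    "\<not> int p dvd n'" "y = of_int m' / of_int n'"
    using assms by (auto simp: p_integral_iff)
  have "n \<noteq> 0" "n' \<noteq> 0" using * by auto
  then have "x + y = of_int (m * n' + m' * n) / of_int (n * n')"
    using * by (simp add: field_simps)
  moreover have "\<not> int p dvd n * n'"
    using * assms(1) by (simp add: prime_dvd_mult_iff)
  ultimately show ?thesis unfolding p_integral_iff by blast
qed

lemma p_integral_mult [intro]:
  assumes "prime p" "p_integral p x" "p_integral p y"
  shows "p_integral p (x * y)"
proof -
  obtain m n m' n' where *: "\<not> int p dvd n" "x = of_int m / of_int n"
    "\<not> int p dvd n'" "y = of_int m' / of_int n'"
    using assms by (auto simp: p_integral_iff)
  have "x * y = of_int (m * m') / of_int (n * n')"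
    using * by simp
  moreover have "\<not> int p dvd n * n'"
    using * assms(1) by (simp add: prime_dvd_mult_iff)
  ultimately show ?thesis unfolding p_integral_iff by blast
qed

lemma p_integral_uminus [intro]:
  assumes "prime p" "p_integral p x"
  shows "p_integral p (- x)"
  using p_integral_mult[OF assms(1) p_integral_of_int[OF assms(1), of "-1"] assms(2)] by simp

lemma p_integral_diff [intro]:
  assumes "prime p" "p_integral p x" "p_integral p y"
  shows "p_integral p (x - y)"
  using p_integral_add[OF assms(1,2) p_integral_uminus[OF assms(1,3)]] by simp

lemma p_integral_sum:
  assumes "prime p" "\<And>k. k \<in> I \<Longrightarrow> p_integral p (f k)"
  shows "p_integral p (sum f I)"
  using assms(2)
proof (induction I rule: infinite_finite_induct)
  case (insert k I)
  then show ?case using p_integral_add[OF assms(1)] by simp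
qed (use p_integral_of_int[OF assms(1), of 0] in simp_all)

lemma p_integral_divide_of_int:
  assumes "prime p" "p_integral p x" "\<not> int p dvd n"
  shows "p_integral p (x / of_int n)"
proof -
  have "p_integral p (of_int 1 / of_int n)" using assms(3) unfolding p_integral_iff by blast
  from p_integral_mult[OF assms(1,2) this] show ?thesis by simp
qed

text \<open>Integrality of \<open>x\<close> comes for free from \<open>x = y - p * z\<close>. In the
  theorem this yields that \<open>p\<close> divides the Lucas number without a separate
  argument.\<close>

lemma rat_congI:
  assumes "prime p" "p_integral p y" "p_integral p z" "y - x = of_nat p * z"
  shows "rat_cong x y p"
proof -
  have x: "x = y - of_int (int p) * z" using assms(4) by simp
  have "p_integral p x" unfolding x
    using assms by (intro p_integral_diff p_integral_mult p_integral_of_int)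
  moreover have "x - y = of_nat p * (- z)" using assms(4) by (simp add: algebra_simps)
  ultimately show ?thesis
    unfolding rat_cong_def using assms(1-3) p_integral_uminus by blast
qed

lemma p_integral_fermat_quotient:
  assumes "prime p" "\<not> int p dvd x"
  shows "p_integral p (fermat_quotient p x)"
proof -
  \<comment> \<open>\<open>fermat_theorem\<close> speaks of natural numbers, so \<open>x\<close> is
    replaced by its residue, which may stand in for a negative \<open>x\<close>.\<close>
  define n where "n = nat (x mod int p)"
  have n: "int n = x mod int p"
    using prime_gt_0_nat[OF assms(1)] by (simp add: n_def)
  then have "\<not> p dvd n" using assms(2)
    by (metis dvd_mod_iff dvd_refl int_dvd_int_iff)
  then have "[int (n ^ (p - 1)) = int 1] (mod int p)"
    using fermat_theorem[OF assms(1)] by (simp only: cong_int_iff)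
  then have "[x ^ (p - 1) = 1] (mod int p)"
    by (simp add: n cong_def power_mod)
  then have "int p dvd x ^ (p - 1) - 1" by (simp add: cong_iff_dvd_diff)
  then obtain m where "x ^ (p - 1) - 1 = int p * m" ..
  then have "(of_int (x ^ (p - 1) - 1) :: rat) = of_int (int p * m)" by (simp only:)
  then have "fermat_quotient p x = of_int m"
    unfolding fermat_quotient_def using prime_gt_0_nat[OF assms(1)] by simp
  then show ?thesis using assms(1) by simp
qed

lemma power_prime_fermat_quotient:
  assumes "p > 0"
  shows "(of_int x :: rat) ^ p = of_int x * (of_nat p * fermat_quotient p x + 1)"
  unfolding fermat_quotient_def using assms by (cases p) simp_all

section \<open>Binomial expansion by residue classes modulo 4\<close>

text \<open>The terms \<open>k = 0\<close> and \<open>k = p\<close> are excluded, so for prime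
  \<open>p\<close> every binomial coefficient here is divisible by \<open>p\<close>.\<close>

definition binomial_class :: "nat \<Rightarrow> int \<Rightarrow> nat \<Rightarrow> int" where
  "binomial_class p a r = (\<Sum>k\<in>{k\<in>{1..<p}. k mod 4 = r}. int (p choose k) * a ^ k)"

lemma power_mod_4:
  fixes w :: "'a::monoid_mult"
  assumes "w ^ 4 = 1"
  shows "w ^ k = w ^ (k mod 4)"
  by (metis assms div_mult_mod_eq mult.commute mult_1 power_add power_mult power_one)

text \<open>Since \<open>w ^ k\<close> depends only on \<open>k mod 4\<close>, it is constant on
  each class and can be pulled out. The ring is left general: \<open>w = 1\<close> and
  \<open>w = -1\<close> are used over the integers, \<open>w = \<i>\<close> over the complex
  numbers.\<close>

lemma binomial_fourth_root:
  fixes w :: "'a::comm_ring_1"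
  assumes "w ^ 4 = 1" "p > 0"
  shows "(1 + w * of_int a) ^ p = 1 + w ^ p * of_int a ^ p + of_int (binomial_class p a 0)
     + w * of_int (binomial_class p a 1) + w ^ 2 * of_int (binomial_class p a 2)
     + w ^ 3 * of_int (binomial_class p a 3)"
proof -
  let ?f = "\<lambda>k. of_nat (p choose k) * (w * of_int a) ^ k :: 'a"
  have part: "(\<Sum>k\<in>{k\<in>{1..<p}. k mod 4 = r}. ?f k) = w ^ r * of_int (binomial_class p a r)" for r
    unfolding binomial_class_def of_int_sum sum_distrib_left
  proof (rule sum.cong[OF refl])
    fix k assume "k \<in> {k\<in>{1..<p}. k mod 4 = r}"
    then have "w ^ k = w ^ r" using power_mod_4[OF assms(1), of k] by simp
    then show "?f k = w ^ r * of_int (int (p choose k) * a ^ k)"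
      by (simp add: power_mult_distrib)
  qed
  have "(1 + w * of_int a) ^ p = (w * of_int a + 1) ^ p" by (simp add: add.commute)
  also have "\<dots> = (\<Sum>k\<le>p. ?f k)" by (simp add: binomial_ring)
  also have "{..p} = insert 0 (insert p {1..<p})" using assms(2) by auto
  also have "(\<Sum>k\<in>\<dots>. ?f k) = 1 + (w * of_int a) ^ p + (\<Sum>k\<in>{1..<p}. ?f k)"
    using assms(2) by (simp add: add.assoc)
  also have "(\<Sum>k\<in>{1..<p}. ?f k) = (\<Sum>r<4. \<Sum>k\<in>{k\<in>{1..<p}. k mod 4 = r}. ?f k)"
    by (rule sum.group[symmetric]) auto
  also have "\<dots> = (\<Sum>r<4. w ^ r * of_int (binomial_class p a r))"
    by (simp only: part)
  finally show ?thesis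
    by (simp add: eval_nat_numeral power_mult_distrib algebra_simps)
qed

text \<open>The number \<open>1 + \<i> * a\<close> is a root of the characteristic polynomial
  \<open>x^2 - 2 * x + (a^2 + 1)\<close>, so the imaginary parts of its powers obey the same
  recurrence, with initial values \<open>0\<close> and \<open>a\<close>.\<close>

lemma lucas_u_eq_Im:
  "of_int (a * lucas_u 2 (a^2 + 1) n) = Im ((1 + \<i> * of_int a) ^ n)"
proof (induction n rule: induct_nat_012)
  case (ge2 n)
  have "(1 + \<i> * of_int a) ^ 2 = 2 * (1 + \<i> * of_int a) - of_int (a^2 + 1)"
    by (simp add: complex_eq_iff power2_eq_square)
  then have "(1 + \<i> * of_int a) ^ Suc (Suc n)
      = 2 * (1 + \<i> * of_int a) ^ Suc n - of_int (a^2 + 1) * (1 + \<i> * of_int a) ^ n"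
    by (simp add: power2_eq_square algebra_simps)
  from arg_cong[OF this, of Im]
  have "Im ((1 + \<i> * of_int a) ^ Suc (Suc n))
      = 2 * Im ((1 + \<i> * of_int a) ^ Suc n) - of_int (a^2 + 1) * Im ((1 + \<i> * of_int a) ^ n)"
    by simp
  then show ?case
    unfolding ge2[symmetric] by (simp add: algebra_simps)
qed simp_all

text \<open>By Pascal's rule two neighbours in row \<open>p - 1\<close> add up to an inner entry of
  row \<open>p\<close>, which \<open>p\<close> divides; so each entry is minus its predecessor
  modulo \<open>p\<close>.\<close>

lemma binomial_prime_minus_one_cong:
  assumes "prime p" "j < p"
  shows "[int (p - 1 choose j) = (-1) ^ j] (mod int p)"
  using assms(2)
proof (induction j)
  case (Suc j)
  have "p dvd (p choose Suc j)"
    using Suc.prems assms(1) by (intro dvd_choose_prime) auto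
  moreover have "p choose Suc j = (p - 1 choose j) + (p - 1 choose Suc j)"
    using Suc.prems by (cases p) simp_all
  ultimately have "int p dvd int (p - 1 choose j) + int (p - 1 choose Suc j)"
    by (metis int_dvd_int_iff of_nat_add)
  then have "[int (p - 1 choose Suc j) = - int (p - 1 choose j)] (mod int p)"
    by (simp add: cong_iff_dvd_diff add.commute)
  also have "[- int (p - 1 choose j) = - ((-1) ^ j)] (mod int p)"
    using Suc by (simp add: cong_minus_minus_iff)
  finally show ?case by simp
qed simp

text \<open>The comparison is made term by term. It is a sum, not a difference, because
  \<open>(-1) ^ (k - 1) * a ^ k = - ((- a) ^ k)\<close>. The explicit \<open>z\<close> lets the
  relation be substituted into exact identities.\<close>

lemma binomial_class_cong_K_sum:
  assumes p: "prime p" and r: "r < 4"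
  obtains z where "p_integral p z"
    "K_sum p 4 (int r) a + of_int (binomial_class p a r) / of_nat p = of_nat p * z"
proof -
  have p0: "p > 0" using p prime_gt_0_nat by blast
  have "[int k = int r] (mod int 4) \<longleftrightarrow> k mod 4 = r" for k
    using r by (simp only: cong_int_iff) (simp add: cong_def)
  then have I: "{k. 1 \<le> k \<and> k \<le> p - 1 \<and> [int k = int r] (mod int 4)} = {k\<in>{1..<p}. k mod 4 = r}"
    using p0 by auto
  have "\<exists>z. p_integral p z \<and> (- of_int a) ^ k / of_nat k
          + of_int (int (p choose k) * a ^ k) / of_nat p = of_nat p * z"
    if "k \<in> {1..<p}" for k
  proof -
    from that obtain j where k: "k = Suc j" and j: "Suc j < p" by (cases k) auto
    have absorb: "k * (p choose k) = p * (p - 1 choose j)"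
      using binomial_absorption[of j p] k by simp
    have "[int (p - 1 choose j) = (-1) ^ j] (mod int p)"
      using binomial_prime_minus_one_cong[OF p, of j] j by simp
    then obtain m where m: "int (p - 1 choose j) - (-1) ^ j = int p * m"
      by (auto simp: cong_iff_dvd_diff)
    have k0: "(of_nat k :: rat) \<noteq> 0" using k by simp
    have nk: "\<not> int p dvd int k" using that by (auto dest: dvd_imp_le)
    have "of_nat k * of_nat (p choose k) = (of_nat p * of_nat (p - 1 choose j) :: rat)"
      using absorb by (metis of_nat_mult)
    then have "of_int (int (p choose k) * a ^ k) / of_nat p
        = (of_nat (p - 1 choose j) * of_int a ^ k / of_nat k :: rat)"
      using p0 k0 by (simp add: divide_simps mult.commute)
    moreover have "(of_nat (p - 1 choose j) :: rat) = (-1) ^ j + of_nat p * of_int m"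
      using arg_cong[OF m, of "of_int :: int \<Rightarrow> rat"] by (simp add: algebra_simps)
    moreover have "(- of_int a) ^ k = (- ((-1) ^ j) * of_int a ^ k :: rat)"
      unfolding k by (metis mult_minus1 power_Suc power_minus)
    \<comment> \<open>The main terms cancel because \<open>k = Suc j\<close>; only the error
      \<open>p * m\<close> of the binomial congruence survives.\<close>
    ultimately have "(- of_int a) ^ k / of_nat k + of_int (int (p choose k) * a ^ k) / of_nat p
        = of_nat p * (of_int (m * a ^ k) / of_int (int k) :: rat)"
      using k0 by (simp add: field_simps)
    moreover have "p_integral p (of_int (m * a ^ k) / of_int (int k))"
      using nk unfolding p_integral_iff by blast
    ultimately show ?thesis by blast
  qed
  then obtain z where z: "\<And>k. k \<in> {1..<p} \<Longrightarrow> p_integral p (z k)"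
    "\<And>k. k \<in> {1..<p} \<Longrightarrow> (- of_int a) ^ k / of_nat k
          + of_int (int (p choose k) * a ^ k) / of_nat p = of_nat p * z k"
    by metis
  show thesis
  proof
    show "p_integral p (\<Sum>k\<in>{k\<in>{1..<p}. k mod 4 = r}. z k)"
      using p z(1) by (intro p_integral_sum) auto
    show "K_sum p 4 (int r) a + of_int (binomial_class p a r) / of_nat p
        = of_nat p * (\<Sum>k\<in>{k\<in>{1..<p}. k mod 4 = r}. z k)"
      unfolding K_sum_def I binomial_class_def of_int_sum sum_divide_distrib
        sum.distrib[symmetric] sum_distrib_left
      by (rule sum.cong[OF refl]) (use z(2) in simp)
  qed
qed

lemma p_integral_K_sum:
  assumes p: "prime p"
  shows "p_integral p (K_sum p m r a)"
  unfolding K_sum_def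
proof (rule p_integral_sum[OF p])
  fix k assume "k \<in> {k. 1 \<le> k \<and> k \<le> p - 1 \<and> [int k = r] (mod int m)}"
  then have "\<not> int p dvd int k" using prime_gt_0_nat[OF p] by (auto dest: dvd_imp_le)
  from p_integral_divide_of_int[OF p p_integral_of_int[OF p, of "(- a) ^ k"] this]
  show "p_integral p ((- of_int a) ^ k / of_nat k)" by simp
qed

section \<open>Elimination of the classes 2 and 3, and the two residues of \<open>p\<close> modulo
  4\<close>

theorem theorem5p2:
  fixes a :: int and p :: nat and u :: "nat \<Rightarrow> int" and A :: rat
  defines "u \<equiv> lucas_u 2 (a^2 + 1)" and "A \<equiv> of_int a"
  assumes "prime p" and "odd p" and "\<not> int p dvd a * (a^4 - 1)"
  shows "([p = 1] (mod 4) \<longrightarrow>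
           rat_cong (of_int (u (p - 1)) / of_nat p)
             (2 / (A * (A^2 + 1)) * (A * K_sum p 4 0 a - K_sum p 4 1 a)
              + 2 / (A^2 + 1) * fermat_quotient p a
              + (A^2 - 1) / (2 * A * (A^2 + 1))
                  * (fermat_quotient p (a + 1) - fermat_quotient p (a - 1))) p) \<and>
         ([p = 3] (mod 4) \<longrightarrow>
           rat_cong (of_int (u (p + 1)) / of_nat p)
             (- (2 / A) * (A * K_sum p 4 0 a + K_sum p 4 1 a)
              - (A + 1)^2 / (2 * A) * fermat_quotient p (a + 1)
              + (A - 1)^2 / (2 * A) * fermat_quotient p (a - 1)) p)"
proof -
  note p = \<open>prime p\<close>
  have p0: "p > 0" using p prime_gt_0_nat by blast
  define P where "P = (of_nat p :: rat)"
  have P0: "P \<noteq> 0" using p0 by (simp add: P_def)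
  have "\<not> int p dvd 2"
  proof
    assume "int p dvd 2"
    then have "p dvd 2" by (metis int_dvd_int_iff of_nat_numeral)
    then have "p = 2" using p primes_dvd_imp_eq two_is_prime_nat by blast
    then show False using \<open>odd p\<close> by simp
  qed
  \<comment> \<open>The factors account for the bases of the three Fermat quotients and, together
    with 2, for every denominator in the two formulas.\<close>
  moreover have "a * (a^4 - 1) = a * (a^2 + 1) * (a + 1) * (a - 1)"
    by (simp add: algebra_simps eval_nat_numeral)
  ultimately have nd: "\<not> int p dvd a" "\<not> int p dvd a + 1" "\<not> int p dvd a - 1"
      "\<not> int p dvd a^2 + 1" "\<not> int p dvd 2 * a" "\<not> int p dvd a * (a^2 + 1)"
      "\<not> int p dvd 2 * a * (a^2 + 1)"
    using p \<open>\<not> int p dvd a * (a^4 - 1)\<close> by (auto simp: prime_dvd_mult_iff)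
  have A0: "A \<noteq> 0" using nd(1) by (auto simp: A_def)
  have A1: "A^2 + 1 \<noteq> 0"
    by (metis add_nonneg_pos less_irrefl zero_le_power2 zero_less_one)
  define Q Qp Qm where "Q = fermat_quotient p a" and "Qp = fermat_quotient p (a + 1)"
    and "Qm = fermat_quotient p (a - 1)"
  have Qint: "p_integral p Q" "p_integral p Qp" "p_integral p Qm"
    unfolding Q_def Qp_def Qm_def using p nd by (auto intro: p_integral_fermat_quotient)
  define K0 K1 where "K0 = K_sum p 4 0 a" and "K1 = K_sum p 4 1 a"
  have Kint: "p_integral p K0" "p_integral p K1"
    unfolding K0_def K1_def using p by (auto intro: p_integral_K_sum)
  define S where "S r = binomial_class p a r" for r
  obtain z0 z1 where z: "p_integral p z0" "p_integral p z1"
    and z0: "K0 + of_int (S 0) / P = P * z0" and z1: "K1 + of_int (S 1) / P = P * z1"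
    using binomial_class_cong_K_sum[OF p, of 0 a] binomial_class_cong_K_sum[OF p, of 1 a]
    unfolding S_def K0_def K1_def P_def by (metis of_nat_0 of_nat_1 one_less_numeral_iff
        semiring_norm(76) zero_less_numeral)
  have frac: "of_int (S 0) = P * (P * z0 - K0)" "of_int (S 1) = P * (P * z1 - K1)"
    using z0 z1 P0 by (auto simp: field_simps)

  have "(1 + a) ^ p = 1 + a ^ p + S 0 + S 1 + S 2 + S 3"
    using binomial_fourth_root[of "1::int" p a] p0 unfolding S_def by simp
  from arg_cong[OF this, of "of_int :: int \<Rightarrow> rat"]
  have plus: "(A + 1) * (P * Qp + 1) = 1 + A * (P * Q + 1)
      + of_int (S 0) + of_int (S 1) + of_int (S 2) + of_int (S 3)"
    using power_prime_fermat_quotient[OF p0, of a] power_prime_fermat_quotient[OF p0, of "a + 1"]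
    by (simp add: A_def P_def Q_def Qp_def add.commute)
  \<comment> \<open>The expansion at \<open>w = -1\<close> concerns \<open>1 - a\<close>; oddness of
    \<open>p\<close> turns it into a statement about the base \<open>a - 1\<close>.\<close>
  have "- ((a - 1) ^ p) = (1 - a) ^ p"
    using \<open>odd p\<close> by (metis minus_diff_eq power_minus_odd)
  also have "\<dots> = 1 - a ^ p + S 0 - S 1 + S 2 - S 3"
    using binomial_fourth_root[of "-1::int" p a] p0 \<open>odd p\<close> unfolding S_def by simp
  finally have "- ((a - 1) ^ p) = 1 - a ^ p + S 0 - S 1 + S 2 - S 3" .
  from arg_cong[OF this, of "of_int :: int \<Rightarrow> rat"]
  have minus: "- ((A - 1) * (P * Qm + 1)) = 1 - A * (P * Q + 1)
      + of_int (S 0) - of_int (S 1) + of_int (S 2) - of_int (S 3)"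
    using power_prime_fermat_quotient[OF p0, of a] power_prime_fermat_quotient[OF p0, of "a - 1"]
    by (simp add: A_def P_def Q_def Qm_def)
  \<comment> \<open>Half the sum of \<open>plus\<close> and \<open>minus\<close> isolates the even
    classes, half the difference the odd ones.\<close>
  have S23: "of_int (S 2) = (P * ((A - 1) * (- Qm) + (A + 1) * Qp)) / 2 - of_int (S 0)"
       "of_int (S 3) = (P * ((A - 1) * Qm + (A + 1) * Qp)) / 2 - A * P * Q - of_int (S 1)"
    using plus minus by (simp_all add: algebra_simps)

  define \<alpha> where "\<alpha> = 1 + \<i> * of_int a"
  have \<alpha>: "\<alpha> ^ p = 1 + \<i> ^ p * of_int (a ^ p) + of_int (S 0) + \<i> * of_int (S 1)
      - of_int (S 2) - \<i> * of_int (S 3)"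
    using binomial_fourth_root[of \<i> p a] p0 unfolding S_def \<alpha>_def
    by (simp add: eval_nat_numeral)
  have u: "Im (\<alpha> ^ n) = of_int (a * u n)" for n
    unfolding u_def \<alpha>_def lucas_u_eq_Im ..

  have case1: "rat_cong (of_int (u (p - 1)) / P)
             (2 / (A * (A^2 + 1)) * (A * K0 - K1) + 2 / (A^2 + 1) * Q
              + (A^2 - 1) / (2 * A * (A^2 + 1)) * (Qp - Qm)) p" if "[p = 1] (mod 4)"
  proof (rule rat_congI[OF p])
    have "\<i> ^ p = \<i> ^ (p mod 4)" by (rule power_mod_4) (simp add: eval_nat_numeral)
    also have "p mod 4 = 1" using that by (simp add: cong_def)
    finally have "\<i> ^ p = \<i>" by (simp)
    with \<alpha> have Re: "Re (\<alpha> ^ p) = of_int (1 + S 0 - S 2)"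
      and Im: "Im (\<alpha> ^ p) = of_int (a ^ p + S 1 - S 3)"
      by simp_all
    \<comment> \<open>Multiplying by the conjugate \<open>1 - \<i> * a\<close> turns the factor
      \<open>\<alpha>\<close> into its norm \<open>a^2 + 1\<close>; on the left the imaginary part
      becomes \<open>Im - a * Re\<close>.\<close>
    have "\<alpha> ^ p = \<alpha> * \<alpha> ^ (p - 1)" using p0 by (cases p) simp_all
    then have "Im (\<alpha> ^ p) - a * Re (\<alpha> ^ p) = (a^2 + 1) * Im (\<alpha> ^ (p - 1))"
      by (simp add: \<alpha>_def algebra_simps power2_eq_square)
    then have "real_of_int (a ^ p + S 1 - S 3 - a * (1 + S 0 - S 2))
        = of_int ((a^2 + 1) * (a * u (p - 1)))"
      unfolding Re Im u[of "p - 1"] by simp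
    \<comment> \<open>All quantities are integers, so the identity passes from the reals to the
      rationals, where the Fermat quotients live.\<close>
    then have "a ^ p + S 1 - S 3 - a * (1 + S 0 - S 2) = (a^2 + 1) * (a * u (p - 1))"
      by (simp only: of_int_eq_iff)
    from arg_cong[OF this, of "of_int :: int \<Rightarrow> rat"]
    have "(A^2 + 1) * (A * of_int (u (p - 1))) = A * (P * Q + 1)
        + of_int (S 1) - of_int (S 3) - A * (1 + of_int (S 0) - of_int (S 2))"
      using power_prime_fermat_quotient[OF p0, of a] by (simp add: A_def P_def Q_def)
    then have "(A^2 + 1) * (A * of_int (u (p - 1))) = P * (2 * (A * K0 - K1) + 2 * A * Q
         + (A^2 - 1) / 2 * (Qp - Qm) - P * (2 * (A * z0 - z1)))"
      unfolding S23 frac by (simp add: field_simps power2_eq_square)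
    then have *: "of_int (u (p - 1)) / P = (2 * (A * K0 - K1) + 2 * A * Q
         + (A^2 - 1) / 2 * (Qp - Qm) - P * (2 * (A * z0 - z1))) / (A * (A^2 + 1))"
      using A0 A1 P0 by (simp add: nonzero_eq_divide_eq nonzero_divide_eq_eq mult_ac)
    \<comment> \<open>This collects the \<open>z0\<close> and \<open>z1\<close> parts of
      \<open>*\<close>; the \<open>of_int\<close> form matches the closure rules for
      integrality.\<close>
    let ?z = "(of_int 2 * (of_int a * z0 - z1)) / of_int (a * (a^2 + 1))"
    show "p_integral p ?z"
      using p nd z
      by (intro p_integral_divide_of_int p_integral_mult p_integral_diff p_integral_of_int)
    show "2 / (A * (A^2 + 1)) * (A * K0 - K1) + 2 / (A^2 + 1) * Q
        + (A^2 - 1) / (2 * A * (A^2 + 1)) * (Qp - Qm) - of_int (u (p - 1)) / P = of_nat p * ?z"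
      unfolding * using A0 A1 by (simp add: A_def[symmetric] P_def[symmetric] divide_simps) (simp add: algebra_simps)
    have "p_integral p (of_int 2 / of_int (a * (a^2 + 1)) * (of_int a * K0 - K1)
        + of_int 2 / of_int (a^2 + 1) * Q
        + of_int (a^2 - 1) / of_int (2 * a * (a^2 + 1)) * (Qp - Qm))"
      using p nd Kint Qint
      by (intro p_integral_divide_of_int p_integral_mult p_integral_diff p_integral_add
            p_integral_of_int)
    then show "p_integral p (2 / (A * (A^2 + 1)) * (A * K0 - K1) + 2 / (A^2 + 1) * Q
        + (A^2 - 1) / (2 * A * (A^2 + 1)) * (Qp - Qm))"
      by (simp add: A_def)
  qed

  have case3: "rat_cong (of_int (u (p + 1)) / P)
             (- (2 / A) * (A * K0 + K1) - (A + 1)^2 / (2 * A) * Qp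
              + (A - 1)^2 / (2 * A) * Qm) p" if "[p = 3] (mod 4)"
  proof (rule rat_congI[OF p])
    have "\<i> ^ p = \<i> ^ (p mod 4)" by (rule power_mod_4) (simp add: eval_nat_numeral)
    also have "p mod 4 = 3" using that by (simp add: cong_def)
    finally have "\<i> ^ p = - \<i>" by (simp add: eval_nat_numeral)
    with \<alpha> have Re: "Re (\<alpha> ^ p) = of_int (1 + S 0 - S 2)"
      and Im: "Im (\<alpha> ^ p) = of_int (- (a ^ p) + S 1 - S 3)"
      by simp_all
    \<comment> \<open>Here one multiplies by \<open>\<alpha>\<close> itself, so no norm has to be
      divided out and \<open>a^2 + 1\<close> does not enter the denominators.\<close>
    have "Im (\<alpha> ^ p) + a * Re (\<alpha> ^ p) = Im (\<alpha> ^ (p + 1))"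
      by (simp add: \<alpha>_def)
    then have "real_of_int (- (a ^ p) + S 1 - S 3 + a * (1 + S 0 - S 2))
        = of_int (a * u (p + 1))"
      unfolding Re Im u[of "p + 1"] by simp
    then have "- (a ^ p) + S 1 - S 3 + a * (1 + S 0 - S 2) = a * u (p + 1)"
      by (simp only: of_int_eq_iff)
    from arg_cong[OF this, of "of_int :: int \<Rightarrow> rat"]
    have "A * of_int (u (p + 1)) = - (A * (P * Q + 1))
        + of_int (S 1) - of_int (S 3) + A * (1 + of_int (S 0) - of_int (S 2))"
      using power_prime_fermat_quotient[OF p0, of a] by (simp add: A_def P_def Q_def)
    \<comment> \<open>As \<open>\<i> ^ p = - \<i>\<close>, the term \<open>- A * P * Q\<close> from
      \<open>a ^ p\<close> cancels the one contributed by \<open>S 3\<close>; hence \<open>Q\<close>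
      is absent from this case.\<close>
    then have "A * of_int (u (p + 1)) = P * (- 2 * (A * K0 + K1) - (A + 1)^2 / 2 * Qp
         + (A - 1)^2 / 2 * Qm + P * (2 * (A * z0 + z1)))"
      unfolding S23 frac by (simp add: field_simps power2_eq_square)
    then have *: "of_int (u (p + 1)) / P = (- 2 * (A * K0 + K1) - (A + 1)^2 / 2 * Qp
         + (A - 1)^2 / 2 * Qm + P * (2 * (A * z0 + z1))) / A"
      using A0 P0 by (simp add: nonzero_eq_divide_eq nonzero_divide_eq_eq mult_ac)
    let ?z = "(of_int (- 2) * (of_int a * z0 + z1)) / of_int a"
    show "p_integral p ?z"
      using p nd z
      by (intro p_integral_divide_of_int p_integral_mult p_integral_add p_integral_of_int)
    show "- (2 / A) * (A * K0 + K1) - (A + 1)^2 / (2 * A) * Qp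
        + (A - 1)^2 / (2 * A) * Qm - of_int (u (p + 1)) / P = of_nat p * ?z"
      unfolding * using A0 by (simp add: A_def[symmetric] P_def[symmetric] divide_simps) (simp add: algebra_simps)
    have "p_integral p (- (of_int 2 / of_int a) * (of_int a * K0 + K1)
        - of_int ((a + 1)^2) / of_int (2 * a) * Qp + of_int ((a - 1)^2) / of_int (2 * a) * Qm)"
      using p nd Kint Qint
      by (intro p_integral_divide_of_int p_integral_mult p_integral_diff p_integral_add
            p_integral_uminus p_integral_of_int)
    then show "p_integral p (- (2 / A) * (A * K0 + K1) - (A + 1)^2 / (2 * A) * Qp
        + (A - 1)^2 / (2 * A) * Qm)"
      by (simp add: A_def)
  qed

  show ?thesis
    using case1 case3 unfolding P_def K0_def K1_def Q_def Qp_def Qm_def by blast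
qed

end
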